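(* Let $S=\{i_1,i_2,\ldots,i_s\}\subseteq[n+1]$ with $i_1<i_2<\cdots<i_s$ be an $(n+1)$-admissible set. For $1\le \ell\le s$ let $S_{i_\ell}=\{i_1,\ldots,i_{\ell-1},i_\ell-1,i_{\ell+1}-1,\ldots,i_s-1\}$ and $\widehat{S}_{i_\ell}=\{i_1,\ldots,i_{\ell-1},i_{\ell+1}-1,\ldots,i_s-1\}$ (i.e. $S_{i_\ell}$ with the element $i_\ell-1$ removed). Then for every integer $q\geq\max(S)$, \[|\mathcal{P}_S(q+1)|=2|\mathcal{P}_S(q)|+2\sum_{\ell=1}^{s}|\mathcal{P}_{S_{i_\ell}}(q)|+\sum_{\ell=1}^{s}|\mathcal{P}_{\widehat{S}_{i_\ell}}(q)|.\]
   Context: For a positive integer $n$, $[n]=\{1,\dots,n\}$ and $\mathfrak{S}_n$ is the symmetric group, with $\pi\in\mathfrak{S}_n$ written in one-line notation $\pi=\pi_1\pi_2\cdots\pi_n$. A permutation $\pi$ has a peak at index $i$ (necessarily $2\le i\le n-1$) if $\pi_{i-1}<\pi_i>\pi_{i+1}$; $\mathcal{P}(\pi)$ is the set of indices at which $\pi$ has a peak. For a set $T$ of positive integers, $\mathcal{P}_T(q)=\{\pi\in\mathfrak{S}_q:\mathcal{P}(\pi)=T\}$ (possibly empty). A set $S$ is called $n$-admissible if $\mathcal{P}_S(n)\neq\emptyset$. *)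

theory Defs
  imports "HOL-Combinatorics.Permutations"
begin

text \<open>
  The symmetric group on \<open>[n]\<close> is \<open>{\<pi>. \<pi> permutes {1..n}}\<close>. Such a \<open>\<pi>\<close> is the identity
  outside \<open>[n]\<close>, so peaks are explicitly restricted to the indices \<open>2, \<dots>, n - 1\<close>.
\<close>

definition peaks :: "nat \<Rightarrow> (nat \<Rightarrow> nat) \<Rightarrow> nat set" where
  "peaks n \<pi> = {i. 2 \<le> i \<and> i + 1 \<le> n \<and> \<pi> (i - 1) < \<pi> i \<and> \<pi> i > \<pi> (i + 1)}"

definition peak_perms :: "nat set \<Rightarrow> nat \<Rightarrow> (nat \<Rightarrow> nat) set" where
  "peak_perms T q = {\<pi>. \<pi> permutes {1..q} \<and> peaks q \<pi> = T}"

definition admissible :: "nat \<Rightarrow> nat set \<Rightarrow> bool" where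
  "admissible n S \<longleftrightarrow> peak_perms S n \<noteq> {}"

text \<open>
  The set \<open>S = {i\<^sub>1 < \<dots> < i\<^sub>s}\<close> is given by its increasing enumeration \<open>i\<close> on \<open>{1..s}\<close>.
  Below, \<open>shifted_set i s l\<close> is \<open>S\<close> with \<open>i\<^sub>l, \<dots>, i\<^sub>s\<close> each decreased by one, and
  \<open>reduced_set i s l\<close> additionally omits the element \<open>i\<^sub>l - 1\<close>. The elements of an admissible
  set are at least 2, so the subtraction does not truncate.
\<close>

definition shifted_set :: "(nat \<Rightarrow> nat) \<Rightarrow> nat \<Rightarrow> nat \<Rightarrow> nat set" where
  "shifted_set i s l = i ` {1..<l} \<union> (\<lambda>k. i k - 1) ` {l..s}"

definition reduced_set :: "(nat \<Rightarrow> nat) \<Rightarrow> nat \<Rightarrow> nat \<Rightarrow> nat set" where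
  "reduced_set i s l = i ` {1..<l} \<union> (\<lambda>k. i k - 1) ` {l<..s}"

end

theory Submission
  imports Defs
begin

text \<open>
  Every permutation of \<open>[q + 1]\<close> arises uniquely by inserting the letter \<open>q + 1\<close> at some position
  \<open>p\<close> of a permutation \<open>\<sigma>\<close> of \<open>[q]\<close>. Inserting at the right end keeps the peak set, inserting at
  the left end shifts it by one. At an interior position \<open>p\<close> becomes a peak, so \<open>p = i\<^sub>l\<close> for some
  \<open>l\<close>, and at most one of the former neighbours \<open>p - 1\<close> and \<open>p\<close> was a peak of \<open>\<sigma>\<close>; that peak is
  destroyed. Hence the peak set of \<open>\<sigma>\<close> is the reduced set at \<open>l\<close>, possibly with \<open>i\<^sub>l - 1\<close> added,
  which is the shifted set at \<open>l\<close>, or with \<open>i\<^sub>l\<close> added, which is the shifted set at \<open>l + 1\<close>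
  (and is \<open>S\<close> for \<open>l = s\<close>).
\<close>

section \<open>Inserting the largest letter as composition with a cycle\<close>

text \<open>This is the cycle \<open>p\<close> to \<open>q + 1\<close> to \<open>q\<close> and so on
  down to \<open>p + 1\<close> and back to \<open>p\<close>. Precomposing \<open>\<sigma>\<close>
  with it moves the letters from position \<open>p\<close> on one place to the right and puts
  \<open>\<sigma> (q + 1)\<close> at \<open>p\<close>.\<close>

definition ins_cycle :: "nat \<Rightarrow> nat \<Rightarrow> nat \<Rightarrow> nat" where
  "ins_cycle q p j = (if j < p \<or> j > q + 1 then j else if j = p then q + 1 else j - 1)"

lemma ins_cycle_permutes:
  assumes "1 \<le> p" "p \<le> q + 1"
  shows "ins_cycle q p permutes {1..q + 1}"
proof (rule bij_imp_permutes)
  show "bij_betw (ins_cycle q p) {1..q + 1} {1..q + 1}"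
    by (rule bij_betw_byWitness[where f' =
          "\<lambda>j. if j < p then j else if j = q + 1 then p else j + 1"])
      (use assms in \<open>auto simp: ins_cycle_def\<close>)
qed (use assms in \<open>auto simp: ins_cycle_def\<close>)

text \<open>A permutation of \<open>{1..q}\<close> fixes \<open>q + 1\<close>, so the letter that
  the cycle brings to position \<open>p\<close> is \<open>q + 1\<close> itself. Composing with the
  inverse cycle deletes it again.\<close>

lemma bij_betw_ins_cycle:
  assumes "1 \<le> p" "p \<le> q + 1"
  shows "bij_betw (\<lambda>\<sigma>. \<sigma> \<circ> ins_cycle q p) {\<sigma>. \<sigma> permutes {1..q}}
           {\<tau>. \<tau> permutes {1..q + 1} \<and> \<tau> p = q + 1}"
proof -
  let ?c = "ins_cycle q p"
  have c: "?c permutes {1..q + 1}"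
    using assms by (rule ins_cycle_permutes)
  have cp: "?c p = q + 1"
    using assms by (simp add: ins_cycle_def)
  then have cq: "inv ?c (q + 1) = p"
    using permutes_inv_eq[OF c] by blast
  show ?thesis
  proof (rule bij_betw_byWitness[where f' = "\<lambda>\<tau>. \<tau> \<circ> inv ?c"])
    show "(\<lambda>\<sigma>. \<sigma> \<circ> ?c) ` {\<sigma>. \<sigma> permutes {1..q}} \<subseteq> {\<tau>. \<tau> permutes {1..q + 1} \<and> \<tau> p = q + 1}"
    proof clarify
      fix \<sigma> assume \<sigma>: "\<sigma> permutes {1..q}"
      then have "\<sigma> permutes {1..q + 1}"
        by (rule permutes_subset) auto
      moreover have "\<sigma> (q + 1) = q + 1"
        using \<sigma> by (rule permutes_not_in) auto
      ultimately show "\<sigma> \<circ> ?c permutes {1..q + 1} \<and> (\<sigma> \<circ> ?c) p = q + 1"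
        using c cp by (simp add: permutes_compose)
    qed
    show "(\<lambda>\<tau>. \<tau> \<circ> inv ?c) ` {\<tau>. \<tau> permutes {1..q + 1} \<and> \<tau> p = q + 1} \<subseteq> {\<sigma>. \<sigma> permutes {1..q}}"
    proof clarify
      fix \<tau> assume \<tau>: "\<tau> permutes {1..q + 1}" "\<tau> p = q + 1"
      have "\<tau> \<circ> inv ?c permutes {1..q + 1}"
        using c \<tau>(1) by (intro permutes_compose permutes_inv)
      \<comment> \<open>Once \<open>q + 1\<close> is a fixed point, the support shrinks from
        \<open>{1..q + 1}\<close> to \<open>{1..q}\<close>.\<close>
      moreover have "\<forall>x\<in>{1..q + 1} - {1..q}. (\<tau> \<circ> inv ?c) x = x"
      proof
        fix x assume "x \<in> {1..q + 1} - {1..q}"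
        then have "x = q + 1"
          by auto
        with \<tau>(2) cq show "(\<tau> \<circ> inv ?c) x = x"
          by simp
      qed
      ultimately show "\<tau> \<circ> inv ?c permutes {1..q}"
        by (blast intro: permutes_superset)
    qed
  qed (use permutes_inv_o[OF c] in \<open>auto simp: comp_assoc\<close>)
qed

section \<open>Effect of an insertion on the peak set\<close>

lemma permutes_le: "\<sigma> permutes {1..q} \<Longrightarrow> 1 \<le> j \<Longrightarrow> j \<le> q \<Longrightarrow> \<sigma> j \<le> q"
  using permutes_in_image[of \<sigma> "{1..q}" j] by auto

lemma peaks_ins_left:
  assumes "\<sigma> permutes {1..q}"
  shows "peaks (q + 1) (\<sigma> \<circ> ins_cycle q 1) = Suc ` peaks q \<sigma>"
proof (rule set_eqI)
  fix j
  have "\<sigma> (q + 1) = q + 1"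
    using assms by (rule permutes_not_in) auto
  with permutes_le[OF assms, of 1]
  show "j \<in> peaks (q + 1) (\<sigma> \<circ> ins_cycle q 1) \<longleftrightarrow> j \<in> Suc ` peaks q \<sigma>"
    \<comment> \<open>Index 2 is the one whose left neighbour is the new letter, which keeps it from
      being a peak.\<close>
    by (cases j; cases "j = 2") (auto simp: peaks_def ins_cycle_def image_iff)
qed

lemma peaks_ins_right:
  assumes "\<sigma> permutes {1..q}"
  shows "peaks (q + 1) (\<sigma> \<circ> ins_cycle q (q + 1)) = peaks q \<sigma>"
proof (rule set_eqI)
  fix j
  have "\<sigma> (q + 1) = q + 1"
    using assms by (rule permutes_not_in) auto
  with permutes_le[OF assms, of q]
  show "j \<in> peaks (q + 1) (\<sigma> \<circ> ins_cycle q (q + 1)) \<longleftrightarrow> j \<in> peaks q \<sigma>"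
    \<comment> \<open>Index \<open>q\<close> has no right neighbour before the insertion and a
      larger one after it, so it is a peak in neither word.\<close>
    by (cases "j = q") (auto simp: peaks_def ins_cycle_def)
qed

text \<open>The positions next to the new letter cannot be peaks. Any other old position keeps both
  its neighbours, so its peak survives, shifted if it lies to the right of \<open>p\<close>.\<close>

lemma peaks_ins_interior:
  assumes "\<sigma> permutes {1..q}" "2 \<le> p" "p \<le> q"
  shows "peaks (q + 1) (\<sigma> \<circ> ins_cycle q p) =
    {t \<in> peaks q \<sigma>. t + 1 < p} \<union> {p} \<union> Suc ` {t \<in> peaks q \<sigma>. p < t}"
proof (rule set_eqI)
  fix j
  have q: "\<sigma> (q + 1) = q + 1"
    using assms(1) by (rule permutes_not_in) auto
  have l: "\<sigma> (p - 1) \<le> q" and r: "\<sigma> p \<le> q"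
    using permutes_le[OF assms(1)] assms(2,3) by auto
  consider "j + 1 < p" | "j + 1 = p" | "j = p" | "j = p + 1" | k where "j = Suc k" "p < k"
    by (metis Suc_eq_plus1 Suc_lessI add.commute less_Suc_eq_0_disj not_less_eq not_less_iff_gr_or_eq old.nat.exhaust)
  then show "j \<in> peaks (q + 1) (\<sigma> \<circ> ins_cycle q p) \<longleftrightarrow>
      j \<in> {t \<in> peaks q \<sigma>. t + 1 < p} \<union> {p} \<union> Suc ` {t \<in> peaks q \<sigma>. p < t}"
    by cases (use assms(2,3) q l r in \<open>auto simp: peaks_def ins_cycle_def image_iff\<close>)
qed

section \<open>Recovering the old peak set from the new one\<close>

lemma peaks_ge_2: "t \<in> peaks q \<sigma> \<Longrightarrow> 2 \<le> t"
  by (simp add: peaks_def)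

lemma peaks_not_consecutive: "t \<in> peaks q \<sigma> \<Longrightarrow> Suc t \<notin> peaks q \<sigma>"
  by (auto simp: peaks_def)

text \<open>The insertion forgets whether \<open>p - 1\<close> and \<open>p\<close> belong to
  \<open>T\<close>, and \<open>S\<close> forces \<open>T\<close> to agree with \<open>R\<close>
  everywhere else. Since \<open>T\<close> cannot contain both, three candidates remain.\<close>

lemma insertion_preimage:
  fixes S T :: "nat set"
  assumes S: "\<And>t. t \<in> S \<Longrightarrow> Suc t \<notin> S" and "p \<in> S" "2 \<le> p"
    and T: "\<not> (p - 1 \<in> T \<and> p \<in> T)"
    and R: "R = {t \<in> S. t < p} \<union> (\<lambda>t. t - 1) ` {t \<in> S. p < t}"
  shows "{t \<in> T. t + 1 < p} \<union> {p} \<union> Suc ` {t \<in> T. p < t} = S \<longleftrightarrow>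
    T = R \<or> T = insert (p - 1) R \<or> T = insert p R" (is "?I = S \<longleftrightarrow> _")
proof -
  have pS: "p - 1 \<notin> S" "Suc p \<notin> S"
    using S[of "p - 1"] S[of p] assms(2,3) by auto
  have I: "t \<in> ?I \<longleftrightarrow> t + 1 < p \<and> t \<in> T \<or> t = p \<or> p + 1 < t \<and> t - 1 \<in> T" for t
    by (cases t) auto
  have Rt: "t \<in> R \<longleftrightarrow> t + 1 < p \<and> t \<in> S \<or> p < t \<and> Suc t \<in> S" for t
  proof -
    have "t \<in> (\<lambda>t. t - 1) ` {t \<in> S. p < t} \<longleftrightarrow> p < t \<and> Suc t \<in> S"
    proof
      assume "t \<in> (\<lambda>t. t - 1) ` {t \<in> S. p < t}"
      then obtain u where u: "u \<in> S" "p < u" "t = u - 1"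
        by blast
      with pS have "u \<noteq> Suc p"
        by blast
      with u show "p < t \<and> Suc t \<in> S"
        by auto
    next
      assume "p < t \<and> Suc t \<in> S"
      then show "t \<in> (\<lambda>t. t - 1) ` {t \<in> S. p < t}"
        by (intro image_eqI[of _ _ "Suc t"]) auto
    qed
    moreover have "t \<in> S \<and> t < p \<longleftrightarrow> t + 1 < p \<and> t \<in> S"
      using pS by (cases "t = p - 1") auto
    ultimately show ?thesis
      unfolding R by blast
  qed
  have "?I = S \<longleftrightarrow> (\<forall>t. t + 1 < p \<or> p < t \<longrightarrow> (t \<in> T \<longleftrightarrow> t \<in> R))" (is "_ \<longleftrightarrow> ?A")
  proof
    assume eq: "?I = S"
    show ?A
    proof clarify
      fix t assume "t + 1 < p \<or> p < t"
      then show "t \<in> T \<longleftrightarrow> t \<in> R"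
        using I[of t] I[of "Suc t"] unfolding eq Rt by auto
    qed
  next
    assume A: ?A
    show "?I = S"
    proof (rule set_eqI)
      fix t
      consider "t + 1 < p" | "t = p - 1" | "t = p" | "t = p + 1" | "p + 1 < t"
        by linarith
      then show "t \<in> ?I \<longleftrightarrow> t \<in> S"
        unfolding I
        by cases (use A[rule_format, of t] A[rule_format, of "t - 1"] Rt[of t] Rt[of "t - 1"]
            pS assms(2,3) in auto)
    qed
  qed
  also have "\<dots> \<longleftrightarrow> T = R \<or> T = insert (p - 1) R \<or> T = insert p R"
  proof
    assume A: ?A
    have "t + 1 < p \<or> p < t \<or> t = p - 1 \<or> t = p" for t
      by linarith
    moreover have "p - 1 \<notin> R" "p \<notin> R"
      using assms(3) by (auto simp: Rt)
    \<comment> \<open>\<open>R\<close> avoids \<open>p - 1\<close> and \<open>p\<close>, so the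
      freedom left to \<open>T\<close> is a subset of these two.\<close>
    ultimately have "T = R \<union> (T \<inter> {p - 1, p})"
      using A by blast
    with T show "T = R \<or> T = insert (p - 1) R \<or> T = insert p R"
      by blast
  qed (use assms(3) in auto)
  finally show ?thesis .
qed

section \<open>Counting by the position of the largest letter\<close>

lemma finite_peak_perms [simp]: "finite (peak_perms T q)"
  by (rule finite_subset[OF _ finite_permutations[of "{1..q}"]]) (auto simp: peak_perms_def)

lemma peak_perms_disjoint: "T \<noteq> U \<Longrightarrow> peak_perms T q \<inter> peak_perms U q = {}"
  by (auto simp: peak_perms_def)

lemma card_peak_perms_max_at:
  assumes "1 \<le> p" "p \<le> q + 1"
  shows "card {\<tau> \<in> peak_perms S (q + 1). \<tau> p = q + 1} =
    card {\<sigma>. \<sigma> permutes {1..q} \<and> peaks (q + 1) (\<sigma> \<circ> ins_cycle q p) = S}"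
proof (rule bij_betw_same_card[symmetric])
  let ?f = "\<lambda>\<sigma>. \<sigma> \<circ> ins_cycle q p"
  have "{\<tau> \<in> peak_perms S (q + 1). \<tau> p = q + 1} =
      {\<tau> \<in> ?f ` {\<sigma>. \<sigma> permutes {1..q}}. peaks (q + 1) \<tau> = S}"
    unfolding bij_betw_imp_surj_on[OF bij_betw_ins_cycle[OF assms]]
    by (auto simp: peak_perms_def)
  also have "\<dots> = ?f ` {\<sigma>. \<sigma> permutes {1..q} \<and> peaks (q + 1) (?f \<sigma>) = S}"
    by blast
  finally show "bij_betw ?f {\<sigma>. \<sigma> permutes {1..q} \<and> peaks (q + 1) (?f \<sigma>) = S}
      {\<tau> \<in> peak_perms S (q + 1). \<tau> p = q + 1}"
    by (intro bij_betw_subset[OF bij_betw_ins_cycle[OF assms]]) auto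
qed

text \<open>Here \<open>R\<close> is the reduced set, written without the enumeration of
  \<open>S\<close>. The three preimage sets are distinct, so their permutation classes are disjoint
  and the cardinalities add.\<close>

lemma card_peak_perms_max_interior:
  assumes S: "\<And>t. t \<in> S \<Longrightarrow> Suc t \<notin> S" and "p \<in> S" "2 \<le> p" "p \<le> q"
    and R: "R = {t \<in> S. t < p} \<union> (\<lambda>t. t - 1) ` {t \<in> S. p < t}"
  shows "card {\<tau> \<in> peak_perms S (q + 1). \<tau> p = q + 1} =
    card (peak_perms R q) + card (peak_perms (insert (p - 1) R) q) + card (peak_perms (insert p R) q)"
proof -
  have "p - 1 \<notin> R" "p \<notin> R"
    using S[of "p - 1"] S[of p] assms(2,3) by (auto simp: R)
  then have ne: "R \<noteq> insert (p - 1) R" "R \<noteq> insert p R" "insert (p - 1) R \<noteq> insert p R"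
    using assms(3) by auto
  have "{\<sigma>. \<sigma> permutes {1..q} \<and> peaks (q + 1) (\<sigma> \<circ> ins_cycle q p) = S} =
      peak_perms R q \<union> peak_perms (insert (p - 1) R) q \<union> peak_perms (insert p R) q"
  proof (rule set_eqI)
    fix \<sigma>
    have "\<not> (p - 1 \<in> peaks q \<sigma> \<and> p \<in> peaks q \<sigma>)"
      using peaks_not_consecutive[of "p - 1" q \<sigma>] assms(3) by auto
    from insertion_preimage[OF S assms(2,3) this R]
    have "peaks (q + 1) (\<sigma> \<circ> ins_cycle q p) = S \<longleftrightarrow>
        peaks q \<sigma> = R \<or> peaks q \<sigma> = insert (p - 1) R \<or> peaks q \<sigma> = insert p R"
      if "\<sigma> permutes {1..q}"
      unfolding peaks_ins_interior[OF that assms(3,4)] .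
    then show "\<sigma> \<in> {\<sigma>. \<sigma> permutes {1..q} \<and> peaks (q + 1) (\<sigma> \<circ> ins_cycle q p) = S} \<longleftrightarrow>
      \<sigma> \<in> peak_perms R q \<union> peak_perms (insert (p - 1) R) q \<union> peak_perms (insert p R) q"
      unfolding peak_perms_def by blast
  qed
  moreover have "card (peak_perms R q \<union> peak_perms (insert (p - 1) R) q \<union> peak_perms (insert p R) q) =
      card (peak_perms R q) + card (peak_perms (insert (p - 1) R) q) + card (peak_perms (insert p R) q)"
    using ne by (simp add: card_Un_disjoint Int_Un_distrib2 peak_perms_disjoint)
  ultimately show ?thesis
    using card_peak_perms_max_at[of p q S] assms(3,4) by simp
qed

lemma card_peak_perms_max_left:
  assumes "\<And>t. t \<in> S \<Longrightarrow> 2 \<le> t"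
  shows "card {\<tau> \<in> peak_perms S (q + 1). \<tau> 1 = q + 1} = card (peak_perms ((\<lambda>t. t - 1) ` S) q)"
proof -
  \<comment> \<open>All elements of \<open>S\<close> are positive, so \<open>Suc\<close> undoes the
    truncated subtraction.\<close>
  have "S = Suc ` (\<lambda>t. t - 1) ` S"
    using assms by (force simp: image_image)
  then have "Suc ` T = S \<longleftrightarrow> T = (\<lambda>t. t - 1) ` S" for T
    using inj_image_eq_iff[of Suc T "(\<lambda>t. t - 1) ` S"] by simp
  then have "{\<sigma>. \<sigma> permutes {1..q} \<and> peaks (q + 1) (\<sigma> \<circ> ins_cycle q 1) = S} =
      peak_perms ((\<lambda>t. t - 1) ` S) q"
    unfolding peak_perms_def by (intro Collect_cong conj_cong refl) (simp only: peaks_ins_left)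
  then show ?thesis
    using card_peak_perms_max_at[of 1 q S] by simp
qed

lemma card_peak_perms_max_right:
  "card {\<tau> \<in> peak_perms S (q + 1). \<tau> (q + 1) = q + 1} = card (peak_perms S q)"
proof -
  have "{\<sigma>. \<sigma> permutes {1..q} \<and> peaks (q + 1) (\<sigma> \<circ> ins_cycle q (q + 1)) = S} = peak_perms S q"
    unfolding peak_perms_def by (intro Collect_cong conj_cong refl) (simp only: peaks_ins_right)
  then show ?thesis
    using card_peak_perms_max_at[of "q + 1" q S] by simp
qed

text \<open>The largest letter stands at an end or, being larger than both neighbours, at a peak,
  hence at an element of \<open>S\<close>. The two ends give the first two summands.\<close>

lemma card_peak_perms_Suc:
  assumes "q \<ge> 1" and "\<And>t. t \<in> S \<Longrightarrow> 2 \<le> t \<and> t \<le> q"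
  shows "card (peak_perms S (q + 1)) = card (peak_perms S q) + card (peak_perms ((\<lambda>t. t - 1) ` S) q)
    + (\<Sum>p\<in>S. card {\<tau> \<in> peak_perms S (q + 1). \<tau> p = q + 1})"
proof -
  let ?A = "\<lambda>p. {\<tau> \<in> peak_perms S (q + 1). \<tau> p = q + 1}"
  have S: "S \<subseteq> {2..q}" "finite S"
    using assms(2) by (auto intro: finite_subset[of S "{2..q}"])
  have "peak_perms S (q + 1) \<subseteq> (\<Union>p\<in>insert 1 (insert (q + 1) S). ?A p)"
  proof
    fix \<tau> assume \<tau>: "\<tau> \<in> peak_perms S (q + 1)"
    then have perm: "\<tau> permutes {1..q + 1}" and pk: "peaks (q + 1) \<tau> = S"
      by (auto simp: peak_perms_def)
    have "q + 1 \<in> \<tau> ` {1..q + 1}"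
      using permutes_image[OF perm] by auto
    then obtain p where p: "p \<in> {1..q + 1}" "\<tau> p = q + 1"
      by (metis imageE)
    have "p \<in> S" if "p \<noteq> 1" "p \<noteq> q + 1"
    proof -
      have less: "\<tau> j < \<tau> p" if "j \<in> {1..q + 1}" "j \<noteq> p" for j
        using permutes_le[OF perm, of j] permutes_inj[OF perm] that p
        by (metis atLeastAtMost_iff inj_eq le_neq_implies_less)
      have "\<tau> (p - 1) < \<tau> p" "\<tau> (p + 1) < \<tau> p"
        using that p(1) by (auto intro!: less)
      then show ?thesis
        using that p(1) by (auto simp: peaks_def simp flip: pk)
    qed
    with \<tau> p show "\<tau> \<in> (\<Union>p\<in>insert 1 (insert (q + 1) S). ?A p)"
      by auto
  qed
  then have "peak_perms S (q + 1) = (\<Union>p\<in>insert 1 (insert (q + 1) S). ?A p)"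
    by blast
  moreover have "card (\<Union>p\<in>insert 1 (insert (q + 1) S). ?A p) = (\<Sum>p\<in>insert 1 (insert (q + 1) S). card (?A p))"
  proof (rule card_UN_disjoint)
    have "p = p'" if "\<tau> permutes {1..q + 1}" "\<tau> p = q + 1" "\<tau> p' = q + 1" for \<tau> p p'
      using permutes_inj[OF that(1)] that(2,3) by (metis injD)
    then show "\<forall>p\<in>insert 1 (insert (q + 1) S). \<forall>p'\<in>insert 1 (insert (q + 1) S).
        p \<noteq> p' \<longrightarrow> ?A p \<inter> ?A p' = {}"
      unfolding peak_perms_def by blast
  qed (use S in auto)
  moreover have "(\<Sum>p\<in>insert 1 (insert (q + 1) S). card (?A p)) =
      card (?A 1) + (card (?A (q + 1)) + (\<Sum>p\<in>S. card (?A p)))"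
  proof -
    \<comment> \<open>The two ends are different positions because \<open>q \<ge> 1\<close>, and
      \<open>S\<close> lies strictly between them.\<close>
    have "1 \<notin> insert (q + 1) S" "q + 1 \<notin> S"
      using S assms(1) by auto
    then show ?thesis
      using S(2) by (simp del: One_nat_def)
  qed
  ultimately show ?thesis
    using card_peak_perms_max_left[of S q] card_peak_perms_max_right[of S q] assms(2) by simp
qed

theorem theorem2:
  fixes n s q :: nat and i :: "nat \<Rightarrow> nat" and S :: "nat set"
  assumes "n \<ge> 1"
    and "strict_mono_on {1..s} i"
    and "S = i ` {1..s}"
    and "S \<subseteq> {1..n + 1}"
    and "admissible (n + 1) S"
    and "q \<ge> 1"
    and "S \<noteq> {} \<longrightarrow> q \<ge> Max S"
  shows "card (peak_perms S (q + 1)) =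
    2 * card (peak_perms S q)
    + 2 * (\<Sum>l = 1..s. card (peak_perms (shifted_set i s l) q))
    + (\<Sum>l = 1..s. card (peak_perms (reduced_set i s l) q))"
proof -
  let ?f = "\<lambda>l. card (peak_perms (shifted_set i s l) q)"
  let ?r = "\<lambda>l. card (peak_perms (reduced_set i s l) q)"
  let ?A = "\<lambda>p. card {\<tau> \<in> peak_perms S (q + 1). \<tau> p = q + 1}"
  obtain \<pi> where "peaks (n + 1) \<pi> = S"
    using assms(5) by (auto simp: admissible_def peak_perms_def)
  \<comment> \<open>Admissibility enters through one witness: \<open>S\<close> is an actual peak
    set, so it starts at 2 or later and has no consecutive elements.\<close>
  then have ge2: "2 \<le> t" and nc: "Suc t \<notin> S" if "t \<in> S" for t
    using that peaks_ge_2 peaks_not_consecutive by blast+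
  have le_q: "t \<le> q" if "t \<in> S" for t
    using that assms(3,7) Max_ge[of S t] by (fastforce simp: assms(3))
  have less_iff: "i k < i l \<longleftrightarrow> k < l" if "k \<in> {1..s}" "l \<in> {1..s}" for k l
    using assms(2) that by (simp add: strict_mono_on_less)
  have A: "?A (i l) = ?r l + ?f l + ?f (Suc l)" if l: "l \<in> {1..s}" for l
  proof -
    let ?R = "{t \<in> S. t < i l} \<union> (\<lambda>t. t - 1) ` {t \<in> S. i l < t}"
    have lS: "i l \<in> S"
      using l assms(3) by blast
    have "{t \<in> S. t < i l} = i ` {1..<l}"
      using l less_iff[OF _ l] unfolding assms(3) by auto
    moreover have "{t \<in> S. i l < t} = i ` {l<..s}"
      using l less_iff[OF l] unfolding assms(3) by auto
    ultimately have R: "?R = reduced_set i s l"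
      by (simp add: reduced_set_def image_image)
    have "{l..s} = insert l {l<..s}" "{1..<Suc l} = insert l {1..<l}" "{Suc l..s} = {l<..s}"
      using l by auto
    \<comment> \<open>Passing from \<open>l\<close> to \<open>Suc l\<close> leaves
      \<open>i l\<close> undecreased, so the two extensions of the reduced set are neighbouring
      shifted sets.\<close>
    then have "insert (i l - 1) ?R = shifted_set i s l" "insert (i l) ?R = shifted_set i s (Suc l)"
      unfolding R by (simp_all add: reduced_set_def shifted_set_def)
    with R card_peak_perms_max_interior[OF nc lS ge2[OF lS] le_q[OF lS] refl] show ?thesis
      by simp
  qed
  have "inj_on i {1..s}"
    using assms(2) by (rule strict_mono_on_imp_inj_on)
  then have "(\<Sum>p\<in>S. ?A p) = (\<Sum>l = 1..s. ?A (i l))"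
    unfolding assms(3) by (subst sum.reindex) auto
  also have "\<dots> = (\<Sum>l = 1..s. ?r l) + (\<Sum>l = 1..s. ?f l) + (\<Sum>l = 1..s. ?f (Suc l))"
    using A by (simp add: sum.distrib)
  finally have sumA: "(\<Sum>p\<in>S. ?A p) = \<dots>" .
  \<comment> \<open>Both sides are the sum of \<open>?f\<close> over \<open>1..Suc s\<close>, split
    off at the first or at the last index.\<close>
  have shift: "?f 1 + (\<Sum>l = 1..s. ?f (Suc l)) = (\<Sum>l = 1..s. ?f l) + ?f (Suc s)"
  proof -
    have "?f 1 + (\<Sum>l = 1..s. ?f (Suc l)) = (\<Sum>l = 1..Suc s. ?f l)"
      by (subst sum.atLeast_Suc_atMost) (simp_all add: sum.shift_bounds_cl_Suc_ivl del: sum.cl_ivl_Suc)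
    then show ?thesis
      by simp
  qed
  \<comment> \<open>The boundary values: \<open>?f 1\<close> is the left-end term, and
    \<open>?f (Suc s)\<close> counts \<open>peak_perms S q\<close>, giving its second copy beside
    the right-end term.\<close>
  have "shifted_set i s 1 = (\<lambda>t. t - 1) ` S" "shifted_set i s (Suc s) = S"
    by (simp_all add: shifted_set_def assms(3) image_image atLeastLessThanSuc_atLeastAtMost)
  then show ?thesis
    using card_peak_perms_Suc[OF assms(6), of S] ge2 le_q sumA shift by simp
qed

end
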